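(* Let $\mathbb{K}$ be $\mathbb{C}$ or $\mathbb{R}$ and let $\mathfrak{h}_2$ be the $5$-dimensional Heisenberg Lie algebra over $\mathbb{K}$ with basis $\{e_1,\dots,e_5\}$ and nonzero brackets $[e_1,e_3]=e_5$, $[e_2,e_4]=e_5$ (up to skew-symmetry). For $p,q\in\mathbb{K}$ let $\phi_6(p:q):\mathfrak{h}_2\times\mathfrak{h}_2\to\mathfrak{h}_2$ be the skew-symmetric bilinear map with $$\phi_6(e_1,e_3)=pe_1,\quad \phi_6(e_2,e_3)=e_1+qe_2,\quad \phi_6(e_3,e_4)=-qe_4,\quad \phi_6(e_3,e_5)=-2qe_5,$$ and all other values on pairs $(e_i,e_j)$ with $i<j$ equal to zero. Then for all $p,q\in\mathbb{K}$ the map $\phi_6(p:q)$ is a $2$-cocycle of $\mathfrak{h}_2$ with adjoint coefficients, and $\mu_t(d_6)(p:q)=[-,-]+t\,\phi_6(p:q)$, i.e. the bracket with nonzero values (up to skew-symmetry) $$[e_1,e_3]_t=e_5+pte_1,\quad [e_2,e_3]_t=te_1+qte_2,\quad [e_2,e_4]_t=e_5,\quad [e_3,e_4]_t=-qte_4,\quad [e_3,e_5]_t=-2qte_5,$$ is an infinitesimal deformation of $\mathfrak{h}_2$. Moreover, the linear span in $H^2(\mathfrak{h}_2,\mathfrak{h}_2)$ of the cohomology classes of the cocycles $\phi_6(p:q)$, $p,q\in\mathbb{K}$, is $3$-dimensional.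
   Context: For a Lie algebra $(\mathfrak{g},[-,-])$ over $\mathbb{K}$, $C^q(\mathfrak{g},\mathfrak{g})=\mathrm{Hom}_{\mathbb{K}}(\Lambda^q\mathfrak{g},\mathfrak{g})$ is the Chevalley--Eilenberg cochain space with adjoint coefficients, with differential $d$, and $H^q(\mathfrak{g},\mathfrak{g})$ denotes its cohomology. A $2$-cochain $\phi$ is a $2$-cocycle iff the cyclic sum over $(x,y,z)$ of $[x,\phi(y,z)]+\phi(x,[y,z])$ vanishes for all $x,y,z\in\mathfrak{g}$; the $2$-coboundaries are the maps $(x,y)\mapsto f([x,y])-[f(x),y]-[x,f(y)]$ with $f:\mathfrak{g}\to\mathfrak{g}$ linear. Given a $2$-cochain $\phi$, extend the bracket $[-,-]_t=[-,-]+t\phi$ to $\mathfrak{g}[[t]]$ by $\mathbb{K}[[t]]$-bilinearity. It is called an infinitesimal deformation of $\mathfrak{g}$ if it satisfies the Jacobi identity modulo $t^2$ (equivalently, $\phi$ is a $2$-cocycle). *)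

theory Defs
  imports "HOL-Analysis.Analysis" "HOL-Computational_Algebra.Formal_Power_Series"
begin

section \<open>Lie algebra structures on coordinate spaces and their low-degree cochains\<close>

text \<open>Everything is stated for Lie brackets \<open>br\<close> on the coordinate space \<open>\<bbbK>\<^sup>n\<close>, with linearity
  understood over the ground field (\<open>Vector_Spaces.linear\<close> with respect to \<open>*s\<close>; the unqualified
  constant \<open>linear\<close> would mean real-linear, also for complex scalars).\<close>

definition alternating_bilinear ::
    "('k::field^'n \<Rightarrow> 'k^'n \<Rightarrow> 'k^'n) \<Rightarrow> bool" where
  "alternating_bilinear \<phi> \<longleftrightarrow>
     (\<forall>x. Vector_Spaces.linear (*s) (*s) (\<lambda>y. \<phi> x y)) \<and>
     (\<forall>y. Vector_Spaces.linear (*s) (*s) (\<lambda>x. \<phi> x y)) \<and>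
     (\<forall>x. \<phi> x x = 0)"

definition lie_bracket :: "('k::field^'n \<Rightarrow> 'k^'n \<Rightarrow> 'k^'n) \<Rightarrow> bool" where
  "lie_bracket br \<longleftrightarrow> alternating_bilinear br \<and>
     (\<forall>x y z. br x (br y z) + br y (br z x) + br z (br x y) = 0)"

definition two_cocycle ::
    "('k::field^'n \<Rightarrow> 'k^'n \<Rightarrow> 'k^'n) \<Rightarrow> ('k^'n \<Rightarrow> 'k^'n \<Rightarrow> 'k^'n) \<Rightarrow> bool" where
  "two_cocycle br \<phi> \<longleftrightarrow> alternating_bilinear \<phi> \<and>
     (\<forall>x y z. (br x (\<phi> y z) + \<phi> x (br y z))
            + (br y (\<phi> z x) + \<phi> y (br z x))
            + (br z (\<phi> x y) + \<phi> z (br x y)) = 0)"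

definition two_coboundary ::
    "('k::field^'n \<Rightarrow> 'k^'n \<Rightarrow> 'k^'n) \<Rightarrow> ('k^'n \<Rightarrow> 'k^'n \<Rightarrow> 'k^'n) \<Rightarrow> bool" where
  "two_coboundary br \<phi> \<longleftrightarrow>
     (\<exists>f. Vector_Spaces.linear (*s) (*s) f \<and>
          \<phi> = (\<lambda>x y. f (br x y) - br (f x) y - br x (f y)))"

definition cohomologous ::
    "('k::field^'n \<Rightarrow> 'k^'n \<Rightarrow> 'k^'n) \<Rightarrow> ('k^'n \<Rightarrow> 'k^'n \<Rightarrow> 'k^'n) \<Rightarrow>
     ('k^'n \<Rightarrow> 'k^'n \<Rightarrow> 'k^'n) \<Rightarrow> bool" where
  "cohomologous br \<phi> \<psi> \<longleftrightarrow> two_cocycle br \<phi> \<and> two_cocycle br \<psi> \<and>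
     two_coboundary br (\<lambda>x y. \<phi> x y - \<psi> x y)"


section \<open>Infinitesimal deformations\<close>

text \<open>For \<open>\<gg> = \<bbbK>\<^sup>n\<close> the \<open>\<bbbK>[[t]]\<close>-module \<open>\<gg>[[t]]\<close> is rendered as \<open>\<bbbK>[[t]]\<^sup>n\<close>, i.e. as the type
  \<open>'k fps ^ 'n\<close>, with \<open>t = fps_X\<close>; \<open>const_vec\<close> is the inclusion of \<open>\<gg>\<close>.\<close>

definition const_vec :: "'k::zero^'n \<Rightarrow> 'k fps^'n" where
  "const_vec v = (\<chi> i. fps_const (v $ i))"

text \<open>The \<open>\<bbbK>[[t]]\<close>-bilinear extension of \<open>br + t \<phi>\<close> to \<open>\<gg>[[t]]\<close>, written out on the standard
  basis; it is characterised by the lemmas \<open>deformed_bracket_const_vec\<close>,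
  \<open>deformed_bracket_add_left\<close> etc. below.\<close>

definition deformed_bracket ::
    "('k::field^'n \<Rightarrow> 'k^'n \<Rightarrow> 'k^'n) \<Rightarrow> ('k^'n \<Rightarrow> 'k^'n \<Rightarrow> 'k^'n) \<Rightarrow>
     'k fps^'n \<Rightarrow> 'k fps^'n \<Rightarrow> 'k fps^'n" where
  "deformed_bracket br \<phi> x y =
     (\<Sum>i\<in>UNIV. \<Sum>j\<in>UNIV. (x $ i * y $ j) *s
        (const_vec (br (axis i 1) (axis j 1)) + fps_X *s const_vec (\<phi> (axis i 1) (axis j 1))))"

definition infinitesimal_deformation ::
    "('k::field^'n \<Rightarrow> 'k^'n \<Rightarrow> 'k^'n) \<Rightarrow> ('k^'n \<Rightarrow> 'k^'n \<Rightarrow> 'k^'n) \<Rightarrow> bool" where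
  "infinitesimal_deformation br \<phi> \<longleftrightarrow> alternating_bilinear \<phi> \<and>
     (let br\<^sub>t = deformed_bracket br \<phi> in
      \<forall>x y z. \<forall>i. fps_X\<^sup>2 dvd (br\<^sub>t x (br\<^sub>t y z) + br\<^sub>t y (br\<^sub>t z x) + br\<^sub>t z (br\<^sub>t x y)) $ i)"


section \<open>The Heisenberg algebra and the given cochains\<close>

text \<open>\<open>skew_table L\<close> is the skew-symmetric bilinear map with value \<open>v\<close> on \<open>(e\<^sub>i, e\<^sub>j)\<close> for each entry
  \<open>((i, j), v)\<close> of \<open>L\<close>, and zero on all other pairs of basis vectors up to skew-symmetry.
  The scalars may be a field or the ring of power series over it.\<close>

definition skew_table ::
    "(('n \<times> 'n) \<times> ('r::comm_ring_1^'n)) list \<Rightarrow> 'r^'n \<Rightarrow> 'r^'n \<Rightarrow> 'r^'n" where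
  "skew_table L x y = (\<Sum>((i, j), v)\<leftarrow>L. (x $ i * y $ j - x $ j * y $ i) *s v)"

text \<open>In the index type \<open>5\<close> the numerals \<open>1, 2, 3, 4, 5\<close> denote five distinct elements
  (with \<open>5 = 0\<close>).\<close>

abbreviation e :: "5 \<Rightarrow> 'r::comm_ring_1^5" where
  "e i \<equiv> axis i 1"

definition heis :: "'k::field^5 \<Rightarrow> 'k^5 \<Rightarrow> 'k^5" where
  "heis = skew_table [((1, 3), e 5), ((2, 4), e 5)]"

definition phi6 :: "'k::field \<Rightarrow> 'k \<Rightarrow> 'k^5 \<Rightarrow> 'k^5 \<Rightarrow> 'k^5" where
  "phi6 p q = skew_table
     [((1, 3), p *s e 1),
      ((2, 3), e 1 + q *s e 2),
      ((3, 4), (- q) *s e 4),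
      ((3, 5), (- 2 * q) *s e 5)]"

definition mu_d6 :: "'k::field \<Rightarrow> 'k \<Rightarrow> 'k fps^5 \<Rightarrow> 'k fps^5 \<Rightarrow> 'k fps^5" where
  "mu_d6 p q = skew_table
     [((1, 3), e 5 + (fps_const p * fps_X) *s e 1),
      ((2, 3), fps_X *s e 1 + (fps_const q * fps_X) *s e 2),
      ((2, 4), e 5),
      ((3, 4), (- (fps_const q * fps_X)) *s e 4),
      ((3, 5), (- 2 * fps_const q * fps_X) *s e 5)]"


section \<open>Basic facts\<close>

lemma linear_vec_iff:
  "Vector_Spaces.linear (*s) (*s) (f :: 'k::field^'n \<Rightarrow> 'k^'m) \<longleftrightarrow>
     (\<forall>x y. f (x + y) = f x + f y) \<and> (\<forall>c x. f (c *s x) = c *s f x)"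
  by (simp add: Vector_Spaces.linear_iff vec.vector_space_axioms)

lemmas linear_vecD =
  linear_vec_iff[THEN iffD1, THEN conjunct1, rule_format]
  linear_vec_iff[THEN iffD1, THEN conjunct2, rule_format]

lemma alternating_bilinear_iff:
  "alternating_bilinear \<phi> \<longleftrightarrow>
     (\<forall>x y z. \<phi> x (y + z) = \<phi> x y + \<phi> x z) \<and> (\<forall>c x y. \<phi> x (c *s y) = c *s \<phi> x y) \<and>
     (\<forall>x y z. \<phi> (x + y) z = \<phi> x z + \<phi> y z) \<and> (\<forall>c x y. \<phi> (c *s x) y = c *s \<phi> x y) \<and>
     (\<forall>x. \<phi> x x = 0)"
  unfolding alternating_bilinear_def linear_vec_iff by blast

lemma alternating_bilinearD:
  assumes "alternating_bilinear \<phi>"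
  shows "\<phi> x (y + z) = \<phi> x y + \<phi> x z" "\<phi> x (c *s y) = c *s \<phi> x y"
    "\<phi> (x + y) z = \<phi> x z + \<phi> y z" "\<phi> (c *s x) y = c *s \<phi> x y" "\<phi> x x = 0"
  using assms unfolding alternating_bilinear_iff by blast+

lemma alternating_bilinear_skew_table:
  fixes L :: "(('n::finite \<times> 'n) \<times> ('k::field^'n)) list"
  shows "alternating_bilinear (skew_table L)"
  unfolding alternating_bilinear_iff skew_table_def
  by (induction L) (auto simp: vec_eq_iff algebra_simps)

lemma five_distinct [simp]:
  "(1::5) \<noteq> 2" "(1::5) \<noteq> 3" "(1::5) \<noteq> 4" "(1::5) \<noteq> 0" "(2::5) \<noteq> 3" "(2::5) \<noteq> 4" "(2::5) \<noteq> 0"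
  "(3::5) \<noteq> 4" "(3::5) \<noteq> 0" "(4::5) \<noteq> 0" "(5::5) = 0"
  "(2::5) \<noteq> 1" "(3::5) \<noteq> 1" "(4::5) \<noteq> 1" "(0::5) \<noteq> 1" "(3::5) \<noteq> 2" "(4::5) \<noteq> 2" "(0::5) \<noteq> 2"
  "(4::5) \<noteq> 3" "(0::5) \<noteq> 3" "(0::5) \<noteq> 4"
  by simp_all

lemma lie_bracket_heis: "lie_bracket (heis :: 'k::field^5 \<Rightarrow> 'k^5 \<Rightarrow> 'k^5)"
  unfolding lie_bracket_def
proof
  show "alternating_bilinear (heis :: 'k^5 \<Rightarrow> _)"
    unfolding heis_def by (rule alternating_bilinear_skew_table)
  show "\<forall>x y z :: 'k^5. heis x (heis y z) + heis y (heis z x) + heis z (heis x y) = 0"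
    by (simp add: heis_def skew_table_def vec_eq_iff axis_def)
qed

lemma const_vec_axis: "const_vec (axis i 1 :: 'k::field^'n) = axis i 1"
  by (simp add: const_vec_def vec_eq_iff axis_def)

lemma deformed_bracket_add_left:
  "deformed_bracket br \<phi> (x + y) z = deformed_bracket br \<phi> x z + deformed_bracket br \<phi> y z"
  by (simp add: deformed_bracket_def vec_eq_iff algebra_simps sum.distrib)

lemma deformed_bracket_add_right:
  "deformed_bracket br \<phi> x (y + z) = deformed_bracket br \<phi> x y + deformed_bracket br \<phi> x z"
  by (simp add: deformed_bracket_def vec_eq_iff algebra_simps sum.distrib)

lemma deformed_bracket_scale_left:
  "deformed_bracket br \<phi> (c *s x) y = c *s deformed_bracket br \<phi> x y"
  by (simp add: deformed_bracket_def vec_eq_iff algebra_simps sum_distrib_left)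

lemma deformed_bracket_scale_right:
  "deformed_bracket br \<phi> x (c *s y) = c *s deformed_bracket br \<phi> x y"
  by (simp add: deformed_bracket_def vec_eq_iff algebra_simps sum_distrib_left)

lemma const_vec_bilinear_expand:
  assumes "alternating_bilinear \<phi>"
  shows "const_vec (\<phi> x y) = (\<Sum>i\<in>UNIV. \<Sum>j\<in>UNIV.
           (const_vec x $ i * const_vec y $ j) *s const_vec (\<phi> (axis i 1) (axis j 1)))"
proof -
  have sum2: "\<phi> u (sum g S) = (\<Sum>j\<in>S. \<phi> u (g j))" if "finite S" for u S and g :: "'b \<Rightarrow> 'a^'b"
    using that alternating_bilinearD(2)[OF assms, of u 0 0]
    by induction (auto simp: alternating_bilinearD(1)[OF assms])
  have sum1: "\<phi> (sum g S) u = (\<Sum>j\<in>S. \<phi> (g j) u)" if "finite S" for u S and g :: "'b \<Rightarrow> 'a^'b"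
    using that alternating_bilinearD(4)[OF assms, of 0 0 u]
    by induction (auto simp: alternating_bilinearD(3)[OF assms])
  have "\<phi> x y = \<phi> (\<Sum>i\<in>UNIV. x $ i *s axis i 1) (\<Sum>j\<in>UNIV. y $ j *s axis j 1)"
    by (simp add: basis_expansion)
  also have "\<dots> = (\<Sum>i\<in>UNIV. \<Sum>j\<in>UNIV. (x $ i * y $ j) *s \<phi> (axis i 1) (axis j 1))"
    by (subst sum.swap)
       (simp add: sum1 sum2 alternating_bilinearD[OF assms] vec.scale_sum_right mult.commute)
  finally have eq: "\<phi> x y = \<dots>" .
  have csum: "fps_const (sum g S) = (\<Sum>j\<in>S. fps_const (g j))" for g :: "'b \<Rightarrow> 'a" and S
    by (induction S rule: infinite_finite_induct) (auto simp flip: fps_const_add)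
  show ?thesis
    by (subst eq) (simp add: const_vec_def vec_eq_iff csum)
qed

lemma deformed_bracket_const_vec:
  assumes "alternating_bilinear br" "alternating_bilinear \<phi>"
  shows "deformed_bracket br \<phi> (const_vec x) (const_vec y) =
           const_vec (br x y) + fps_X *s const_vec (\<phi> x y)"
  unfolding const_vec_bilinear_expand[OF assms(1), of x y]
    const_vec_bilinear_expand[OF assms(2), of x y] deformed_bracket_def
  by (simp add: vec_eq_iff algebra_simps sum.distrib sum_distrib_left)

lemma two_cocycle_zero: "two_cocycle br (\<lambda>_ _. 0)" if "lie_bracket br"
  using that alternating_bilinearD(2)[of br _ 0 0]
  by (auto simp: two_cocycle_def lie_bracket_def alternating_bilinear_iff)

lemma two_cocycle_add:
  assumes "lie_bracket br" "two_cocycle br \<phi>" "two_cocycle br \<psi>"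
  shows "two_cocycle br (\<lambda>x y. \<phi> x y + \<psi> x y)"
proof -
  have br: "alternating_bilinear br"
    using assms(1) by (simp add: lie_bracket_def)
  have "(br x (\<phi> y z + \<psi> y z) + (\<phi> x (br y z) + \<psi> x (br y z)))
      + (br y (\<phi> z x + \<psi> z x) + (\<phi> y (br z x) + \<psi> y (br z x)))
      + (br z (\<phi> x y + \<psi> x y) + (\<phi> z (br x y) + \<psi> z (br x y))) = 0" for x y z
  proof -
    have "(br x (\<phi> y z) + \<phi> x (br y z)) + (br y (\<phi> z x) + \<phi> y (br z x))
            + (br z (\<phi> x y) + \<phi> z (br x y)) = 0"
      "(br x (\<psi> y z) + \<psi> x (br y z)) + (br y (\<psi> z x) + \<psi> y (br z x))
            + (br z (\<psi> x y) + \<psi> z (br x y)) = 0"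
      using assms unfolding two_cocycle_def by blast+
    from arg_cong2[OF this, of "(+)"] show ?thesis
      unfolding alternating_bilinearD(1)[OF br] by (simp add: ac_simps)
  qed
  moreover have "alternating_bilinear (\<lambda>x y. \<phi> x y + \<psi> x y)"
    using assms unfolding two_cocycle_def alternating_bilinear_iff
    by (simp add: vec.scale_right_distrib)
  ultimately show ?thesis
    unfolding two_cocycle_def by blast
qed

lemma two_cocycle_scale:
  assumes "lie_bracket br" "two_cocycle br \<phi>"
  shows "two_cocycle br (\<lambda>x y. c *s \<phi> x y)"
proof -
  have br: "alternating_bilinear br"
    using assms(1) by (simp add: lie_bracket_def)
  have "(br x (c *s \<phi> y z) + c *s \<phi> x (br y z)) + (br y (c *s \<phi> z x) + c *s \<phi> y (br z x))
      + (br z (c *s \<phi> x y) + c *s \<phi> z (br x y)) = 0" for x y z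
  proof -
    have "(br x (\<phi> y z) + \<phi> x (br y z)) + (br y (\<phi> z x) + \<phi> y (br z x))
            + (br z (\<phi> x y) + \<phi> z (br x y)) = 0"
      using assms unfolding two_cocycle_def by blast
    from arg_cong[OF this, of "(*s) c"] show ?thesis
      unfolding alternating_bilinearD(2)[OF br] by (simp add: vec.scale_right_distrib)
  qed
  moreover have "alternating_bilinear (\<lambda>x y. c *s \<phi> x y)"
    using assms unfolding two_cocycle_def alternating_bilinear_iff
    by (simp add: vec.scale_right_distrib vec.scale_left_commute)
  ultimately show ?thesis
    unfolding two_cocycle_def by blast
qed

lemma two_coboundary_zero: "two_coboundary br (\<lambda>_ _. 0)" if "lie_bracket br"
proof -
  have br: "alternating_bilinear br"
    using that by (simp add: lie_bracket_def)
  show ?thesis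
    unfolding two_coboundary_def
    using alternating_bilinearD(2)[OF br, of _ 0 0] alternating_bilinearD(4)[OF br, of 0 0]
    by (intro exI[of _ "\<lambda>_. 0"]) (simp add: linear_vec_iff)
qed

lemma two_coboundary_add:
  assumes "lie_bracket br" "two_coboundary br \<phi>" "two_coboundary br \<psi>"
  shows "two_coboundary br (\<lambda>x y. \<phi> x y + \<psi> x y)"
proof -
  have br: "alternating_bilinear br"
    using assms(1) by (simp add: lie_bracket_def)
  obtain f g where f: "Vector_Spaces.linear (*s) (*s) f"
      "\<phi> = (\<lambda>x y. f (br x y) - br (f x) y - br x (f y))"
    and g: "Vector_Spaces.linear (*s) (*s) g"
      "\<psi> = (\<lambda>x y. g (br x y) - br (g x) y - br x (g y))"
    using assms unfolding two_coboundary_def by blast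
  have "Vector_Spaces.linear (*s) (*s) (\<lambda>x. f x + g x)"
    using f(1) g(1) unfolding linear_vec_iff by (simp add: vec.scale_right_distrib)
  then show ?thesis
    unfolding two_coboundary_def f(2) g(2)
    by (intro exI[of _ "\<lambda>x. f x + g x"])
       (simp add: alternating_bilinearD[OF br] algebra_simps)
qed

lemma two_coboundary_scale:
  assumes "lie_bracket br" "two_coboundary br \<phi>"
  shows "two_coboundary br (\<lambda>x y. c *s \<phi> x y)"
proof -
  have br: "alternating_bilinear br"
    using assms(1) by (simp add: lie_bracket_def)
  obtain f where f: "Vector_Spaces.linear (*s) (*s) f"
      "\<phi> = (\<lambda>x y. f (br x y) - br (f x) y - br x (f y))"
    using assms unfolding two_coboundary_def by blast
  have "Vector_Spaces.linear (*s) (*s) (\<lambda>x. c *s f x)"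
    using f(1) unfolding linear_vec_iff
    by (simp add: vec.scale_right_distrib vec.scale_left_commute)
  then show ?thesis
    unfolding two_coboundary_def f(2)
    by (intro exI[of _ "\<lambda>x. c *s f x"])
       (simp add: alternating_bilinearD[OF br] vec.scale_right_diff_distrib)
qed

lemma two_coboundary_minus_commute:
  assumes "lie_bracket br" "two_coboundary br (\<lambda>x y. \<phi> x y - \<psi> x y)"
  shows "two_coboundary br (\<lambda>x y. \<psi> x y - \<phi> x y)"
  using two_coboundary_scale[OF assms, of "- 1"] by (simp add: vec.scale_right_diff_distrib)

lemma two_cocycle_if_two_coboundary:
  assumes "lie_bracket br" "two_coboundary br \<phi>"
  shows "two_cocycle br \<phi>"
proof -
  have br: "alternating_bilinear br"
    and jac: "\<And>x y z. br x (br y z) + br y (br z x) + br z (br x y) = 0"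
    using assms(1) by (auto simp: lie_bracket_def)
  have skew: "br y x = - br x y" for x y
  proof -
    have "br (x + y) (x + y) = br x y + br y x"
      using alternating_bilinearD(5)[OF br, of x] alternating_bilinearD(5)[OF br, of y]
      by (simp only: alternating_bilinearD(1,3)[OF br] add_0_left add_0_right add.commute)
    then show ?thesis
      using alternating_bilinearD(5)[OF br, of "x + y"] by (simp add: eq_neg_iff_add_eq_0 add.commute)
  qed
  have neg: "br x (- y) = - br x y" for x y
    using alternating_bilinearD(2)[OF br, of x "-1" y] by simp
  have diff: "br x (y - z) = br x y - br x z" for x y z
    using alternating_bilinearD(1)[OF br, of x y "-z"] neg by simp
  obtain f where f: "Vector_Spaces.linear (*s) (*s) f"
      and \<phi>: "\<phi> = (\<lambda>x y. f (br x y) - br (f x) y - br x (f y))"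
    using assms unfolding two_coboundary_def by blast
  note lin = linear_vecD[OF f]
  have alt: "alternating_bilinear \<phi>"
    unfolding alternating_bilinear_iff \<phi>
    using skew[of "f _"] lin(2)[of 0 0]
    by (auto simp: alternating_bilinearD[OF br] lin vec.scale_right_diff_distrib)
  have "(br x (\<phi> y z) + \<phi> x (br y z)) + (br y (\<phi> z x) + \<phi> y (br z x))
            + (br z (\<phi> x y) + \<phi> z (br x y)) = 0" for x y z
  proof -
    have "f (br x (br y z) + br y (br z x) + br z (br x y)) = 0"
      using jac lin(2)[of 0 0] by simp
    then have f0: "f (br x (br y z)) + f (br y (br z x)) + f (br z (br x y)) = 0"
      by (simp add: lin)
    have "(br x (\<phi> y z) + \<phi> x (br y z)) + (br y (\<phi> z x) + \<phi> y (br z x))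
            + (br z (\<phi> x y) + \<phi> z (br x y)) =
          (f (br x (br y z)) + f (br y (br z x)) + f (br z (br x y)))
          - (br (f x) (br y z) + br y (br z (f x)) + br z (br (f x) y))
          - (br x (br (f y) z) + br (f y) (br z x) + br z (br x (f y)))
          - (br x (br y (f z)) + br y (br (f z) x) + br (f z) (br x y))"
      unfolding \<phi> diff by (simp add: algebra_simps)
    then show ?thesis
      unfolding f0 jac by simp
  qed
  with alt show ?thesis
    unfolding two_cocycle_def by blast
qed

lemma part_equivp_cohomologous:
  assumes "lie_bracket br"
  shows "part_equivp (cohomologous br)"
proof (rule part_equivpI)
  show "\<exists>\<phi>. cohomologous br \<phi> \<phi>"
    using two_cocycle_zero[OF assms] two_coboundary_zero[OF assms]
    by (intro exI[of _ "\<lambda>_ _. 0"]) (simp add: cohomologous_def)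
  show "symp (cohomologous br)"
    using two_coboundary_minus_commute[OF assms] by (auto simp: cohomologous_def intro: sympI)
  show "transp (cohomologous br)"
  proof (rule transpI)
    fix \<phi> \<psi> \<theta> :: "'a^'b \<Rightarrow> 'a^'b \<Rightarrow> 'a^'b"
    assume "cohomologous br \<phi> \<psi>" "cohomologous br \<psi> \<theta>"
    then show "cohomologous br \<phi> \<theta>"
      using two_coboundary_add[OF assms, of "\<lambda>x y. \<phi> x y - \<psi> x y" "\<lambda>x y. \<psi> x y - \<theta> x y"]
      by (auto simp: cohomologous_def)
  qed
qed


section \<open>The second adjoint cohomology of the Heisenberg algebra as a vector space\<close>

text \<open>The quotient of the 2-cocycles by the 2-coboundaries; the abstraction map
  \<open>cohomology_class\<close> is only meaningful on 2-cocycles.\<close>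

quotient_type (overloaded) 'k heis_H2 = "'k::field^5 \<Rightarrow> 'k^5 \<Rightarrow> 'k^5" / partial: "cohomologous heis"
  morphisms class_representative cohomology_class
  by (rule part_equivp_cohomologous[OF lie_bracket_heis])

lift_definition scale_H2 :: "'k::field \<Rightarrow> 'k heis_H2 \<Rightarrow> 'k heis_H2"
  is "\<lambda>c \<phi> x y. c *s \<phi> x y"
  subgoal for c \<phi> \<psi>
    using two_coboundary_scale[OF lie_bracket_heis, of "\<lambda>x y. \<phi> x y - \<psi> x y" c]
    by (auto simp: cohomologous_def two_cocycle_scale[OF lie_bracket_heis]
        vec.scale_right_diff_distrib)
  done

instantiation heis_H2 :: (field) ab_group_add
begin

lift_definition zero_heis_H2 :: "'a heis_H2" is "\<lambda>_ _. 0"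
  using two_cocycle_zero[OF lie_bracket_heis] two_coboundary_zero[OF lie_bracket_heis]
  by (simp add: cohomologous_def)

lift_definition plus_heis_H2 :: "'a heis_H2 \<Rightarrow> 'a heis_H2 \<Rightarrow> 'a heis_H2"
  is "\<lambda>\<phi> \<psi> x y. \<phi> x y + \<psi> x y"
  subgoal for \<phi> \<phi>' \<psi> \<psi>'
    using two_coboundary_add[OF lie_bracket_heis, of "\<lambda>x y. \<phi> x y - \<phi>' x y" "\<lambda>x y. \<psi> x y - \<psi>' x y"]
    by (auto simp: cohomologous_def two_cocycle_add[OF lie_bracket_heis] algebra_simps)
  done

definition uminus_heis_H2 :: "'a heis_H2 \<Rightarrow> 'a heis_H2" where
  "- a = scale_H2 (- 1) a"

definition minus_heis_H2 :: "'a heis_H2 \<Rightarrow> 'a heis_H2 \<Rightarrow> 'a heis_H2" where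
  "a - b = a + - (b :: 'a heis_H2)"

lemma cohomologous_refl: "cohomologous heis \<phi> \<phi> \<longleftrightarrow> two_cocycle heis \<phi>"
  using two_coboundary_zero[OF lie_bracket_heis] by (auto simp: cohomologous_def)

instance
proof
  fix a b c :: "'a heis_H2"
  show "a + b + c = a + (b + c)"
    by transfer (simp add: cohomologous_refl two_cocycle_add[OF lie_bracket_heis] add.assoc)
  show "a + b = b + a"
    by transfer (simp add: cohomologous_refl two_cocycle_add[OF lie_bracket_heis] add.commute)
  show "0 + a = a"
    by transfer (simp add: cohomologous_refl)
  show "- a + a = 0"
    unfolding uminus_heis_H2_def
    by transfer (simp add: cohomologous_refl two_cocycle_zero[OF lie_bracket_heis])
  show "a - b = a + - b"
    by (rule minus_heis_H2_def)
qed

end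

interpretation H2: vector_space "scale_H2 :: 'k::field \<Rightarrow> 'k heis_H2 \<Rightarrow> 'k heis_H2"
proof
  fix a b :: 'k and x y :: "'k heis_H2"
  show "scale_H2 a (x + y) = scale_H2 a x + scale_H2 a y"
    by transfer (simp add: cohomologous_refl two_cocycle_add two_cocycle_scale lie_bracket_heis
        vec.scale_right_distrib)
  show "scale_H2 (a + b) x = scale_H2 a x + scale_H2 b x"
    by transfer (simp add: cohomologous_refl two_cocycle_add two_cocycle_scale lie_bracket_heis
        vec.scale_left_distrib)
  show "scale_H2 a (scale_H2 b x) = scale_H2 (a * b) x"
    by transfer (simp add: cohomologous_refl two_cocycle_scale lie_bracket_heis)
  show "scale_H2 1 x = x"
    by transfer (simp add: cohomologous_refl)
qed

end

theory Submission
  imports Defs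
begin

text \<open>Since \<open>\<phi>\<^sub>6(p:q)\<close> is affine in \<open>(p, q)\<close>, the span of the classes is generated by those of
  \<open>\<phi>\<^sub>6(0:0)\<close>, \<open>\<phi>\<^sub>6(1:0)\<close> and \<open>\<phi>\<^sub>6(0:1)\<close>. These are independent: a coboundary \<open>\<delta>f\<close> takes
  \<open>(e\<^sub>2, e\<^sub>3)\<close> into the centre, and its values at \<open>(e\<^sub>1, e\<^sub>3)\<close> and \<open>(e\<^sub>2, e\<^sub>4)\<close> both agree with
  \<open>f(e\<^sub>5)\<close> modulo the centre.\<close>

text \<open>Coordinate identities become finite checks through this; 0 stands for the index
  5.\<close>

lemma UNIV_five: "(UNIV :: 5 set) = {0, 1, 2, 3, 4}"
  by (rule sym, rule card_subset_eq) simp_all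

lemma all_five: "(\<forall>i :: 5. P i) \<longleftrightarrow> P 0 \<and> P 1 \<and> P 2 \<and> P 3 \<and> P 4"
proof -
  have "(\<forall>i :: 5. P i) \<longleftrightarrow> (\<forall>i \<in> UNIV. P i)"
    by simp
  then show ?thesis
    unfolding UNIV_five by simp
qed

lemma two_cocycle_phi6: "two_cocycle heis (phi6 p q)"
  unfolding two_cocycle_def
proof
  show "alternating_bilinear (phi6 p q)"
    unfolding phi6_def by (rule alternating_bilinear_skew_table)
\<comment> \<open>In each of the five coordinates the cyclic sum cancels as a polynomial in the
  coordinates of the three vectors.\<close>
qed (simp add: heis_def phi6_def skew_table_def vec_eq_iff all_five axis_def algebra_simps)

lemma skew_table_Cons:
  "skew_table (((i, j), v) # L) x y = (x $ i * y $ j - x $ j * y $ i) *s v + skew_table L x y"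
  by (simp add: skew_table_def)

lemma const_vec_add: "const_vec (u + v :: 'k::field^'n) = const_vec u + const_vec v"
  by (simp add: const_vec_def vec_eq_iff flip: fps_const_add)

lemma const_vec_scale: "const_vec (c *s v :: 'k::field^'n) = fps_const c *s const_vec v"
  by (simp add: const_vec_def vec_eq_iff flip: fps_const_mult)

text \<open>A bilinear form is recovered from its values on basis pairs; here the form is the (a, b)
  minor, the coefficient of one table entry.\<close>

lemma sum_axis_minor:
  fixes x y :: "'k::field fps^'n::finite"
  shows "(\<Sum>i\<in>UNIV. \<Sum>j\<in>UNIV. (x $ i * y $ j) *
      fps_const (axis i 1 $ a * axis j 1 $ b - axis i 1 $ b * axis j 1 $ a))
    = x $ a * y $ b - x $ b * y $ a"
proof -
  \<comment> \<open>Basis coordinates are indicators, so each term splits into a factor in i times a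
    factor in j and the double sum factorises.\<close>
  have "(x $ i * y $ j) * fps_const (axis i 1 $ a * axis j 1 $ b - axis i 1 $ b * axis j 1 $ a)
      = (if i = a then x $ i else 0) * (if j = b then y $ j else 0)
        - (if i = b then x $ i else 0) * (if j = a then y $ j else 0)" for i j
    by (simp add: axis_def flip: fps_const_neg)
  then show ?thesis
    by (simp add: sum_subtractf flip: sum_distrib_left sum_distrib_right)
qed

text \<open>Extending scalars to power series only coerces the table values, since each entry
  contributes one minor times its value.\<close>

lemma const_vec_skew_table_extend:
  fixes L :: "(('n::finite \<times> 'n) \<times> ('k::field^'n)) list"
  shows "(\<Sum>i\<in>UNIV. \<Sum>j\<in>UNIV. (x $ i * y $ j) *s const_vec (skew_table L (axis i 1) (axis j 1)))
    = skew_table (map (map_prod id const_vec) L) x y"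
proof (induction L)
  case Nil
  show ?case
    by (simp add: skew_table_def const_vec_def vec_eq_iff)
next
  case (Cons l L)
  obtain a b v where l: "l = ((a, b), v)"
    by (metis surj_pair)
  have "(\<Sum>i\<in>UNIV. \<Sum>j\<in>UNIV. (x $ i * y $ j) *s (fps_const
          (axis i 1 $ a * axis j 1 $ b - axis i 1 $ b * axis j 1 $ a) *s const_vec v))
      = (x $ a * y $ b - x $ b * y $ a) *s const_vec v"
    by (simp add: vec_eq_iff flip: sum_axis_minor mult.assoc sum_distrib_right)
  with Cons.IH show ?case
    unfolding l by (simp only: list.map map_prod_simp id_apply skew_table_Cons const_vec_add
        const_vec_scale vector_add_ldistrib sum.distrib)
qed

text \<open>Replaces the double sum over basis pairs by a single table, with the entries of the
  cochain multiplied by t.\<close>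

lemma deformed_bracket_skew_table:
  "deformed_bracket (skew_table L) (skew_table M) =
     skew_table (map (map_prod id const_vec) L @ map (map_prod id (\<lambda>v. fps_X *s const_vec v)) M)"
proof (intro ext)
  fix x y
  have X: "skew_table (map (map_prod id (\<lambda>v. fps_X *s const_vec v)) M) x y
      = fps_X *s skew_table (map (map_prod id const_vec) M) x y"
    by (induction M) (auto simp: skew_table_def vec_eq_iff algebra_simps)
  have "deformed_bracket (skew_table L) (skew_table M) x y =
      (\<Sum>i\<in>UNIV. \<Sum>j\<in>UNIV. (x $ i * y $ j) *s const_vec (skew_table L (axis i 1) (axis j 1)))
      + fps_X *s
      (\<Sum>i\<in>UNIV. \<Sum>j\<in>UNIV. (x $ i * y $ j) *s const_vec (skew_table M (axis i 1) (axis j 1)))"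
    by (simp add: deformed_bracket_def vec_eq_iff algebra_simps sum.distrib sum_distrib_left)
  also have "\<dots> = skew_table (map (map_prod id const_vec) L
      @ map (map_prod id (\<lambda>v. fps_X *s const_vec v)) M) x y"
    unfolding const_vec_skew_table_extend X[symmetric] by (simp add: skew_table_def)
  finally show "deformed_bracket (skew_table L) (skew_table M) x y = \<dots>" .
qed

lemma deformed_bracket_phi6: "deformed_bracket heis (phi6 p q) = mu_d6 p q"
proof (intro ext)
  fix x y
  show "deformed_bracket heis (phi6 p q) x y = mu_d6 p q x y"
    unfolding heis_def phi6_def mu_d6_def deformed_bracket_skew_table
    \<comment> \<open>Both tables have an entry at (1, 3), which \<open>mu_d6\<close> merges into
      one. The numeral 2 in \<open>mu_d6\<close> is a power series, hence
      \<open>numeral_fps_const\<close>.\<close>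
    by (simp add: skew_table_def vec_eq_iff all_five const_vec_def axis_def)
       (simp add: numeral_fps_const algebra_simps flip: fps_const_neg fps_const_mult)
qed

text \<open>Stated for a scalar \<open>t\<close> in an arbitrary commutative ring, because there it is a polynomial
  identity: the linear term in \<open>t\<close> of the Jacobiator vanishes by the cocycle condition, and the
  quadratic one is the Jacobiator of \<open>\<phi>\<^sub>6(p:q)\<close>.\<close>

lemma jacobiator_skew_table_d6:
  fixes p q t :: "'r::comm_ring_1"
  assumes m: "m = skew_table
     [((1, 3), e 5 + (p * t) *s e 1),
      ((2, 3), t *s e 1 + (q * t) *s e 2),
      ((2, 4), e 5),
      ((3, 4), (- (q * t)) *s e 4),
      ((3, 5), (- 2 * q * t) *s e 5)]"
    and \<phi>: "\<phi> = skew_table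
     [((1, 3), p *s e 1),
      ((2, 3), e 1 + q *s e 2),
      ((3, 4), (- q) *s e 4),
      ((3, 5), (- 2 * q) *s e 5)]"
  shows "m x (m y z) + m y (m z x) + m z (m x y)
      = t\<^sup>2 *s (\<phi> x (\<phi> y z) + \<phi> y (\<phi> z x) + \<phi> z (\<phi> x y))"
  unfolding vec_eq_iff all_five m \<phi> skew_table_def
  by (simp add: axis_def) (simp add: algebra_simps power2_eq_square)

lemma infinitesimal_deformation_phi6: "infinitesimal_deformation heis (phi6 p q)"
proof -
  have "fps_X\<^sup>2 dvd (mu_d6 p q x (mu_d6 p q y z) + mu_d6 p q y (mu_d6 p q z x)
      + mu_d6 p q z (mu_d6 p q x y)) $ i" for x y z i
    \<comment> \<open>The ring is that of power series, with t = \<open>fps_X\<close> and the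
      parameters \<open>fps_const p\<close> and \<open>fps_const q\<close>.\<close>
    by (subst jacobiator_skew_table_d6[OF mu_d6_def refl]) (simp only: vector_smult_component dvd_triv_left)
  then show ?thesis
    using two_cocycle_phi6[of p q]
    unfolding infinitesimal_deformation_def deformed_bracket_phi6 two_cocycle_def Let_def by blast
qed

text \<open>The coefficients are the barycentric coordinates of (p, q) with respect to (0, 0), (1,
  0) and (0, 1).\<close>

lemma phi6_affine:
  "phi6 p q = (\<lambda>x y. (1 - p - q) *s phi6 0 0 x y + (p *s phi6 1 0 x y + q *s phi6 0 1 x y))"
  by (intro ext) (simp add: phi6_def skew_table_def vec_eq_iff all_five axis_def algebra_simps)

lemma two_coboundary_phi6_combination:
  assumes "two_coboundary heis
    (\<lambda>x y. a *s phi6 0 0 x y + (b *s phi6 1 0 x y + c *s phi6 0 1 x y))"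
  shows "a = 0 \<and> b = 0 \<and> c = (0 :: 'k::field)"
proof -
  obtain f where lin: "Vector_Spaces.linear (*s) (*s) (f :: 'k^5 \<Rightarrow> 'k^5)"
    and f: "\<And>x y. a *s phi6 0 0 x y + (b *s phi6 1 0 x y + c *s phi6 0 1 x y)
              = f (heis x y) - heis (f x) y - heis x (f y)"
    using assms unfolding two_coboundary_def by (auto simp: fun_eq_iff)
  have f0: "f 0 = 0"
    using linear_vecD(2)[OF lin, of 0 0] by simp
  have h: "heis (e 1) (e 3) = (e 5 :: 'k^5)" "heis (e 2) (e 4) = (e 5 :: 'k^5)"
    "heis (e 2) (e 3) = (0 :: 'k^5)"
    by (simp_all add: heis_def skew_table_def vec_eq_iff all_five axis_def)
  \<comment> \<open>At \<open>(e 2, e 3)\<close> the combination is (a + b + c) \<open>e 1\<close> +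
    c \<open>e 2\<close>, while the coboundary is a multiple of \<open>e 5\<close>.\<close>
  have "a + b + c = 0" "c = 0"
    using arg_cong[OF f[of "e 2" "e 3"], of "\<lambda>v. v $ 1"]
      arg_cong[OF f[of "e 2" "e 3"], of "\<lambda>v. v $ 2"]
    unfolding h f0
    by (simp_all add: heis_def phi6_def skew_table_def axis_def)
  \<comment> \<open>The combination is b \<open>e 1\<close> at \<open>(e 1, e 3)\<close> and
    vanishes at \<open>(e 2, e 4)\<close>; both brackets equal \<open>e 5\<close>.\<close>
  moreover have "b = f (e 5) $ 1" "f (e 5) $ 1 = 0"
    using arg_cong[OF f[of "e 1" "e 3"], of "\<lambda>v. v $ 1"]
      arg_cong[OF f[of "e 2" "e 4"], of "\<lambda>v. v $ 1"]
    unfolding h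
    by (simp_all add: heis_def phi6_def skew_table_def axis_def)
  ultimately show ?thesis
    by simp
qed

lemma cohomology_class_eq_iff:
  assumes "two_cocycle heis \<phi>" "two_cocycle heis \<psi>"
  shows "cohomology_class \<phi> = cohomology_class \<psi> \<longleftrightarrow> two_coboundary heis (\<lambda>x y. \<phi> x y - \<psi> x y)"
  using Quotient_rel[OF Quotient_heis_H2, of \<phi> \<psi>] assms
  by (simp add: cohomologous_refl) (simp add: cohomologous_def)

lemma cohomology_class_add:
  assumes "two_cocycle heis \<phi>" "two_cocycle heis \<psi>"
  shows "cohomology_class \<phi> + cohomology_class \<psi> = cohomology_class (\<lambda>x y. \<phi> x y + \<psi> x y)"
  using assms by (intro plus_heis_H2.abs_eq) (simp_all add: eq_onp_def cohomologous_refl)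

lemma cohomology_class_scale:
  assumes "two_cocycle heis \<phi>"
  shows "scale_H2 c (cohomology_class \<phi>) = cohomology_class (\<lambda>x y. c *s \<phi> x y)"
  using assms by (intro scale_H2.abs_eq) (simp_all add: eq_onp_def cohomologous_refl)

lemma cohomology_class_phi6_combination:
  "scale_H2 a (cohomology_class (phi6 0 0)) + (scale_H2 b (cohomology_class (phi6 1 0))
      + scale_H2 c (cohomology_class (phi6 0 1)))
    = cohomology_class (\<lambda>x y. a *s phi6 0 0 x y + (b *s phi6 1 0 x y + c *s phi6 0 1 x y))"
  by (simp add: cohomology_class_add cohomology_class_scale two_cocycle_phi6 two_cocycle_add
      two_cocycle_scale lie_bracket_heis)

lemma phi6_classes_independent:
  assumes "scale_H2 a (cohomology_class (phi6 0 0)) + (scale_H2 b (cohomology_class (phi6 1 0))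
      + scale_H2 c (cohomology_class (phi6 0 1))) = 0"
  shows "a = 0 \<and> b = 0 \<and> c = 0"
proof (rule two_coboundary_phi6_combination)
  have "two_cocycle heis (\<lambda>x y. a *s phi6 0 0 x y + (b *s phi6 1 0 x y + c *s phi6 0 1 x y))"
    by (intro two_cocycle_add two_cocycle_scale two_cocycle_phi6 lie_bracket_heis)
  then show "two_coboundary heis (\<lambda>x y. a *s phi6 0 0 x y + (b *s phi6 1 0 x y + c *s phi6 0 1 x y))"
    using assms cohomology_class_eq_iff[OF _ two_cocycle_zero[OF lie_bracket_heis]]
    unfolding cohomology_class_phi6_combination zero_heis_H2.abs_eq by fastforce
qed

lemma dim_span_phi6_classes:
  "H2.dim (H2.span {cohomology_class (phi6 p q) | p q :: 'k::field. True}) = 3"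
proof -
  define A B C :: "'k heis_H2" where "A = cohomology_class (phi6 0 0)"
    and "B = cohomology_class (phi6 1 0)" and "C = cohomology_class (phi6 0 1)"
  have indep: "a = 0 \<and> b = 0 \<and> c = 0"
    if "scale_H2 a A + (scale_H2 b B + scale_H2 c C) = 0" for a b c
    using phi6_classes_independent that unfolding A_def B_def C_def by blast
  \<comment> \<open>An equality of two classes would be a relation with coefficients 1 and -1.
    Distinctness keeps three separate summands in the sum over \<open>{A, B, C}\<close> and gives
    its cardinality.\<close>
  have distinct: "A \<noteq> B" "A \<noteq> C" "B \<noteq> C"
    using indep[of 1 "- 1" 0] indep[of 1 0 "- 1"] indep[of 0 1 "- 1"] by auto
  have "H2.independent {A, B, C}"
  proof (rule H2.independent_if_scalars_zero)
    fix f x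
    assume "(\<Sum>x\<in>{A, B, C}. scale_H2 (f x) x) = 0" "x \<in> {A, B, C}"
    then show "f x = 0"
      using indep[of "f A" "f B" "f C"] distinct by auto
  qed simp
  moreover have "H2.span {A, B, C} = H2.span {cohomology_class (phi6 p q) | p q :: 'k. True}"
    (is "_ = H2.span ?S")
  proof (rule H2.span_eq[THEN iffD2], intro conjI subsetI)
    fix x
    assume "x \<in> ?S"
    then obtain p q where "x = cohomology_class (phi6 p q)"
      by blast
    then have "x = scale_H2 (1 - p - q) A + (scale_H2 p B + scale_H2 q C)"
      unfolding A_def B_def C_def cohomology_class_phi6_combination
      by (simp add: phi6_affine[of p q])
    then show "x \<in> H2.span {A, B, C}"
      by (simp add: H2.span_add H2.span_scale H2.span_base)
  qed (auto simp: A_def B_def C_def intro!: H2.span_base)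
  moreover have "card {A, B, C} = 3"
    using distinct by simp
  ultimately show ?thesis
    by (metis H2.dim_span_eq_card_independent)
qed

theorem theorem4p4:
  shows
    "((\<forall>p q :: complex.
         two_cocycle heis (phi6 p q) \<and>
         deformed_bracket heis (phi6 p q) = mu_d6 p q \<and>
         infinitesimal_deformation heis (phi6 p q)) \<and>
      H2.dim (H2.span {cohomology_class (phi6 p q) | p q :: complex. True}) = 3)
     \<and>
     ((\<forall>p q :: real.
         two_cocycle heis (phi6 p q) \<and>
         deformed_bracket heis (phi6 p q) = mu_d6 p q \<and>
         infinitesimal_deformation heis (phi6 p q)) \<and>
      H2.dim (H2.span {cohomology_class (phi6 p q) | p q :: real. True}) = 3)"
  by (intro conjI allI two_cocycle_phi6 deformed_bracket_phi6 infinitesimal_deformation_phi6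
      dim_span_phi6_classes)

end
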